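(* Let $P$ be a $1$-nearly simple convex polytope. Then the face lattice of $P$ can be determined from the graph of $P$.
   Context: All polytopes are convex polytopes. The (edge-vertex) graph $G_P$ of a polytope $P$ has as vertices the vertices of $P$, with two vertices adjacent iff some $1$-dimensional face of $P$ contains both. A $d$-dimensional polytope $P$ is $h$-nearly simple if $\deg_{G_P}(v)=d$ for all but exactly $h$ vertices $v$ of $P$. "The face lattice can be determined from the graph" means that the face lattice of $P$ (up to isomorphism) is determined by the abstract graph $G_P$: any $1$-nearly simple polytope whose graph is isomorphic to $G_P$ has face lattice isomorphic to that of $P$. *)

theory Defs
  imports "HOL-Analysis.Analysis"
begin

definition poly_vertices :: "'a::euclidean_space set \<Rightarrow> 'a set" where
  "poly_vertices P = {v. v extreme_point_of P}"

definition poly_adj :: "'a::euclidean_space set \<Rightarrow> 'a \<Rightarrow> 'a \<Rightarrow> bool" where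
  "poly_adj P u v \<longleftrightarrow> u \<in> poly_vertices P \<and> v \<in> poly_vertices P \<and> u \<noteq> v \<and>
     (\<exists>F. F face_of P \<and> aff_dim F = 1 \<and> u \<in> F \<and> v \<in> F)"

definition poly_degree :: "'a::euclidean_space set \<Rightarrow> 'a \<Rightarrow> nat" where
  "poly_degree P v = card {u. poly_adj P v u}"

definition nearly_simple :: "nat \<Rightarrow> 'a::euclidean_space set \<Rightarrow> bool" where
  "nearly_simple h P \<longleftrightarrow> polytope P \<and>
     card {v \<in> poly_vertices P. int (poly_degree P v) \<noteq> aff_dim P} = h"

definition graph_iso :: "'a::euclidean_space set \<Rightarrow> 'b::euclidean_space set \<Rightarrow> bool" where
  "graph_iso P Q \<longleftrightarrow> (\<exists>g. bij_betw g (poly_vertices P) (poly_vertices Q) \<and>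
     (\<forall>u\<in>poly_vertices P. \<forall>v\<in>poly_vertices P. poly_adj P u v \<longleftrightarrow> poly_adj Q (g u) (g v)))"

text \<open>Isomorphism of face lattices (all faces, including the empty face and the
  polytope itself, ordered by inclusion).\<close>
definition face_lattice_iso :: "'a::euclidean_space set \<Rightarrow> 'b::euclidean_space set \<Rightarrow> bool" where
  "face_lattice_iso P Q \<longleftrightarrow> (\<exists>f. bij_betw f {F. F face_of P} {G. G face_of Q} \<and>
     (\<forall>F1. F1 face_of P \<longrightarrow> (\<forall>F2. F2 face_of P \<longrightarrow> (F1 \<subseteq> F2 \<longleftrightarrow> f F1 \<subseteq> f F2))))"

end

theory Submission
  imports Defs
begin

text \<open>This is Kalai's argument, adapted to one nonsimple vertex \<open>v0\<close>. Call an acyclic orientation of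
  the graph good if every nonempty face has exactly one sink. Among the orientations in which
  \<open>v0\<close> is a source, and likewise among those in which \<open>v0\<close> is a sink, the number of faces with sink
  \<open>v0\<close> is constant, while a simple vertex of in-degree \<open>k\<close> is a sink of exactly \<open>2 ^ k\<close> faces. Hence
  in both classes the good orientations are the minimisers of the sum of these powers over the simple
  vertices, so they can be read off the graph. Every face occurs as an initial set of a good
  orientation: with \<open>v0\<close> as a source if the face contains \<open>v0\<close>, and with \<open>v0\<close> as a sink otherwise.
  Conversely, the image in another polytope of such an initial set \<open>F\<close> is a face: the edges at its
  top vertex \<open>x\<close> span a face with unique sink \<open>x\<close>, which lies in the image because the image is
  initial, and equals it because all simple vertices have the same degree in both and each vertex of
  \<open>F\<close> has an ascending path to \<open>x\<close> that does not pass through \<open>v0\<close>.\<close>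

section \<open>Vertices and edges of a polytope and of its faces\<close>

lemma poly_vertices_subset: "poly_vertices P \<subseteq> P"
  by (auto simp: poly_vertices_def extreme_point_of_def)

lemma finite_poly_vertices: "polytope P \<Longrightarrow> finite (poly_vertices P)"
  unfolding poly_vertices_def
  by (simp add: finite_polyhedron_extreme_points polytope_imp_polyhedron)

lemma polytope_eq_hull_vertices: "polytope P \<Longrightarrow> P = convex hull (poly_vertices P)"
  unfolding poly_vertices_def
  by (simp add: Krein_Milman_Minkowski polytope_imp_compact polytope_imp_convex)

lemma poly_vertices_face: "F face_of P \<Longrightarrow> poly_vertices F = poly_vertices P \<inter> F"
  by (auto simp: poly_vertices_def extreme_point_of_face)

lemma face_eq_hull_vertices:
  "\<lbrakk>polytope P; F face_of P\<rbrakk> \<Longrightarrow> F = convex hull (poly_vertices P \<inter> F)"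
  by (metis face_of_polytope_polytope poly_vertices_face polytope_eq_hull_vertices)

lemma face_has_vertex:
  "\<lbrakk>polytope P; F face_of P; F \<noteq> {}\<rbrakk> \<Longrightarrow> poly_vertices P \<inter> F \<noteq> {}"
  by (metis convex_hull_empty face_eq_hull_vertices)

lemma polytope_affine_le:
  assumes "polytope P" "\<And>v. v \<in> poly_vertices P \<Longrightarrow> a \<bullet> v \<le> b" "x \<in> P"
  shows "a \<bullet> x \<le> b"
proof -
  have "convex hull (poly_vertices P) \<subseteq> {x. a \<bullet> x \<le> b}"
    by (rule hull_minimal) (use assms convex_halfspace_le in auto)
  with assms polytope_eq_hull_vertices[OF assms(1)] show ?thesis by auto
qed

lemma poly_adj_sym: "poly_adj P u v \<longleftrightarrow> poly_adj P v u"
  by (auto simp: poly_adj_def)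

lemma poly_adjD:
  assumes "poly_adj P u v"
  shows "u \<in> poly_vertices P" "v \<in> poly_vertices P" "u \<noteq> v"
  using assms by (simp_all add: poly_adj_def)

text \<open>An edge \<open>E\<close> of \<open>P\<close> with both ends in \<open>F\<close> meets
  \<open>F\<close> in a face of \<open>E\<close> that is still of dimension 1, hence is all of
  \<open>E\<close>. So \<open>E\<close> is an edge of \<open>F\<close>, and the graph of a face is
  an induced subgraph of the graph of \<open>P\<close>.\<close>

lemma poly_adj_face:
  assumes "F face_of P"
  shows "poly_adj F u v \<longleftrightarrow> poly_adj P u v \<and> u \<in> F \<and> v \<in> F"
proof
  assume "poly_adj F u v"
  then show "poly_adj P u v \<and> u \<in> F \<and> v \<in> F"
    unfolding poly_adj_def using assms by (auto simp: poly_vertices_face dest: face_of_trans)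
next
  assume R: "poly_adj P u v \<and> u \<in> F \<and> v \<in> F"
  then obtain E where E: "E face_of P" "aff_dim E = 1" "u \<in> E" "v \<in> E" "u \<noteq> v"
    by (auto simp: poly_adj_def)
  have "E \<inter> F face_of E"
    by (metis E(1) assms face_of_Int face_of_subset inf_le1 face_of_imp_subset)
  moreover have "aff_dim {u, v} \<le> aff_dim (E \<inter> F)"
    by (rule aff_dim_subset) (use E R in auto)
  then have "\<not> aff_dim (E \<inter> F) < aff_dim E"
    using E by (simp add: aff_dim_2)
  ultimately have "E \<inter> F = E"
    using face_of_aff_dim_lt face_of_imp_convex E(1) by blast
  then have "E face_of F"
    using E(1) assms by (metis face_of_face inf_le2)
  with E R show "poly_adj F u v"
    using assms by (auto simp: poly_adj_def poly_vertices_face)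
qed

section \<open>Supporting hyperplanes and the cone of edges at a vertex\<close>

lemma face_exposing_functional:
  fixes P :: "'a::euclidean_space set"
  assumes "polytope P" "F face_of P"
  obtains a b where "\<And>x. x \<in> P \<Longrightarrow> a \<bullet> x \<le> b" "F = P \<inter> {x. a \<bullet> x = b}"
proof -
  have "F exposed_face_of P"
    using assms exposed_face_of_polyhedron polytope_imp_polyhedron by blast
  with that show thesis by (auto simp: exposed_face_of_def)
qed

text \<open>The set \<open>K\<close> below is the vertex figure at \<open>w\<close>, with \<open>w\<close> moved to the origin.\<close>
lemma vertex_figure_extreme_point:
  fixes P :: "'a::euclidean_space set"
  assumes P: "polytope P" and w: "w \<in> poly_vertices P"
    and h: "\<And>v. v \<in> poly_vertices P \<Longrightarrow> v \<noteq> w \<Longrightarrow> h \<bullet> (v - w) > 0"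
    and y: "y extreme_point_of convex hull ((\<lambda>v. (v - w) /\<^sub>R (h \<bullet> (v - w))) ` (poly_vertices P - {w}))"
  obtains u where "poly_adj P w u" "u - w = (h \<bullet> (u - w)) *\<^sub>R y" "h \<bullet> (u - w) > 0"
proof -
  define d where "d v = (v - w) /\<^sub>R (h \<bullet> (v - w))" for v
  define V where "V = poly_vertices P"
  define K where "K = convex hull (d ` (V - {w}))"
  have finV: "finite V" using P finite_poly_vertices V_def by blast
  have yK: "y extreme_point_of K" using y unfolding K_def V_def d_def[abs_def] .
  have dv: "v - w = (h \<bullet> (v - w)) *\<^sub>R d v" if "v \<in> V" for v
    using h[of v] that by (cases "v = w") (auto simp: d_def V_def)
  have "y \<in> d ` (V - {w})"
    using yK unfolding K_def by (rule extreme_point_of_convex_hull)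
  then obtain u where u: "u \<in> V" "u \<noteq> w" "y = d u" by blast
  have "polytope K" unfolding K_def using finV by (simp add: polytope_convex_hull)
  then obtain a b where ab: "\<And>x. x \<in> K \<Longrightarrow> a \<bullet> x \<le> b" "{y} = K \<inter> {x. a \<bullet> x = b}"
    using yK face_of_singleton face_exposing_functional by metis
  have dK: "d v \<in> K" if "v \<in> V" "v \<noteq> w" for v
    using that unfolding K_def by (auto intro: hull_inc)
  \<comment> \<open>Every \<open>d v\<close> satisfies \<open>h \<bullet> d v = 1\<close>, so the
    affine inequality a \<le> b on \<open>K\<close> becomes the linear inequality m \<le> 0 on the
    directions \<open>v - w\<close>. The hyperplane of \<open>m\<close> through \<open>w\<close>
    then supports \<open>P\<close>.\<close>
  define m where "m = a - b *\<^sub>R h"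
  have m: "m \<bullet> (v - w) = (h \<bullet> (v - w)) * (a \<bullet> d v - b)" if "v \<in> V" for v
  proof -
    have "a \<bullet> (v - w) = (h \<bullet> (v - w)) * (a \<bullet> d v)"
      using arg_cong[OF dv[OF that], of "\<lambda>x. a \<bullet> x"] by simp
    then show ?thesis by (simp add: m_def inner_diff_left algebra_simps)
  qed
  have mle: "m \<bullet> v \<le> m \<bullet> w" if "v \<in> V" for v
  proof (cases "v = w")
    case False
    have "m \<bullet> (v - w) \<le> 0"
      unfolding m[OF that] using h[of v] that False ab(1)[OF dK[OF that False]]
      by (auto simp: V_def mult_nonneg_nonpos)
    then show ?thesis by (simp add: inner_diff_right)
  qed auto
  have meq: "v = w \<or> d v = y" if v: "v \<in> V" and "m \<bullet> v = m \<bullet> w" for v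
  proof (cases "v = w")
    case False
    have "(h \<bullet> (v - w)) * (a \<bullet> d v - b) = 0"
      using m[OF v] that by (simp add: inner_diff_right)
    then have "a \<bullet> d v = b" using h[of v] v False by (auto simp: V_def)
    then show ?thesis using ab(2) dK[OF v False] by auto
  qed auto
  define F where "F = P \<inter> {x. m \<bullet> x = m \<bullet> w}"
  have F: "F face_of P"
    unfolding F_def
  proof (rule face_of_Int_supporting_hyperplane_le)
    show "convex P" using P by (rule polytope_imp_convex)
    show "m \<bullet> x \<le> m \<bullet> w" if "x \<in> P" for x
      by (rule polytope_affine_le[OF P _ that]) (simp add: mle V_def)
  qed
  have wF: "w \<in> F" using w poly_vertices_subset unfolding F_def by auto
  have "a \<bullet> d u = b" using ab(2) u(3) by blast
  then have mu: "m \<bullet> u = m \<bullet> w"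
    using m[OF u(1)] by (simp add: inner_diff_right)
  have uF: "u \<in> F"
    using u mu poly_vertices_subset[of P] unfolding F_def V_def by auto
  have "F = convex hull (V \<inter> F)"
    using face_eq_hull_vertices[OF P F] unfolding V_def .
  \<comment> \<open>The vertices on the supporting hyperplane are \<open>w\<close> and those
    projecting to \<open>y\<close> from \<open>w\<close>, so they lie on one line and
    \<open>F\<close> is the required edge.\<close>
  also have "\<dots> \<subseteq> affine hull {w, u}"
  proof -
    have "v \<in> affine hull {w, u}" if v: "v \<in> V \<inter> F" for v
    proof -
      have "v = w \<or> d v = d u" using meq[of v] v u(3) by (auto simp: F_def)
      then show ?thesis
      proof
        assume e: "d v = d u"
        have "v - w = (h \<bullet> (v - w)) *\<^sub>R d u" using dv[of v] v e by auto
        also have "d u = (u - w) /\<^sub>R (h \<bullet> (u - w))" by (simp add: d_def)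
        finally have "v = w + ((h \<bullet> (v - w)) / (h \<bullet> (u - w))) *\<^sub>R (u - w)"
          by (simp add: divide_inverse algebra_simps)
        then show ?thesis unfolding affine_hull_2_alt by blast
      qed (simp add: hull_inc)
    qed
    then show ?thesis by (meson hull_minimal subsetI affine_affine_hull affine_imp_convex)
  qed
  finally have "aff_dim F \<le> aff_dim {w, u}"
    by (metis aff_dim_affine_hull aff_dim_subset)
  moreover have "aff_dim {w, u} \<le> aff_dim F"
    using wF uF by (intro aff_dim_subset) auto
  ultimately have "aff_dim F = 1" using u(2) by (auto simp: aff_dim_2 split: if_splits)
  then have "poly_adj P w u"
    unfolding poly_adj_def using w u F wF uF by (auto simp: V_def)
  moreover have "u - w = (h \<bullet> (u - w)) *\<^sub>R y" using dv[OF u(1)] u(3) by simp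
  ultimately show thesis using that h[of u] u by (auto simp: V_def)
qed

lemma finite_poly_adj: "polytope P \<Longrightarrow> finite {u. poly_adj P w u}"
  by (rule finite_subset[OF _ finite_poly_vertices]) (auto simp: poly_adj_def)

text \<open>Each extreme point of the vertex figure \<open>K\<close> is a positive multiple of an
  edge direction at \<open>w\<close>, and \<open>K\<close> is the hull of its extreme points. So
  \<open>K\<close> lies in the cone \<open>C\<close> of the edges, and scaling back puts every
  vertex, hence all of \<open>P\<close>, in the translate of \<open>C\<close> by
  \<open>w\<close>.\<close>

lemma vertex_edge_cone:
  fixes P :: "'a::euclidean_space set"
  assumes P: "polytope P" and w: "w \<in> poly_vertices P" and x: "x \<in> P"
  obtains c where "\<And>u. c u \<ge> 0" "x - w = (\<Sum>u | poly_adj P w u. c u *\<^sub>R (u - w))"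
proof -
  define N where "N = {u. poly_adj P w u}"
  have finN: "finite N" unfolding N_def using P finite_poly_adj by blast
  define C where "C = {z. \<exists>c. (\<forall>u. c u \<ge> 0) \<and> z = (\<Sum>u\<in>N. c u *\<^sub>R (u - w))}"
  have C0: "0 \<in> C" unfolding C_def by (auto intro!: exI[of _ "\<lambda>_. 0"])
  have Cs: "t *\<^sub>R z \<in> C" if "z \<in> C" "t \<ge> 0" for t z
  proof -
    obtain c where "\<forall>u. c u \<ge> 0" "z = (\<Sum>u\<in>N. c u *\<^sub>R (u - w))" using \<open>z \<in> C\<close> by (auto simp: C_def)
    then show ?thesis
      using \<open>t \<ge> 0\<close> unfolding C_def by (auto intro!: exI[of _ "\<lambda>u. t * c u"] simp: scaleR_sum_right)
  qed
  have Ca: "z + z' \<in> C" if zz: "z \<in> C" "z' \<in> C" for z z'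
  proof -
    obtain c where "\<forall>u. c u \<ge> 0" "z = (\<Sum>u\<in>N. c u *\<^sub>R (u - w))" using zz by (auto simp: C_def)
    moreover obtain c' where "\<forall>u. c' u \<ge> 0" "z' = (\<Sum>u\<in>N. c' u *\<^sub>R (u - w))" using zz by (auto simp: C_def)
    ultimately show ?thesis
      unfolding C_def by (auto intro!: exI[of _ "\<lambda>u. c u + c' u"] simp: sum.distrib scaleR_add_left)
  qed
  have Cc: "convex C" unfolding convex_def using Cs Ca by auto
  have CN: "u - w \<in> C" if "u \<in> N" for u
  proof -
    have "(\<Sum>v\<in>N. (if v = u then 1 else 0) *\<^sub>R (v - w)) = (\<Sum>v\<in>N. if v = u then v - w else 0)"
      by (rule sum.cong) auto
    also have "\<dots> = u - w" using that finN by simp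
    finally show ?thesis unfolding C_def by (auto intro!: exI[of _ "\<lambda>v. if v = u then 1 else 0"])
  qed
  have "{w} face_of P" using w by (simp add: poly_vertices_def face_of_singleton)
  then obtain a b where ab: "\<And>x. x \<in> P \<Longrightarrow> a \<bullet> x \<le> b" "{w} = P \<inter> {x. a \<bullet> x = b}"
    using face_exposing_functional[OF P] by metis
  define h where "h = - a"
  have h: "h \<bullet> (v - w) > 0" if "v \<in> poly_vertices P" "v \<noteq> w" for v
  proof -
    have "v \<in> P" using that poly_vertices_subset by blast
    then have "a \<bullet> v \<le> b" "a \<bullet> v \<noteq> b" "a \<bullet> w = b" using ab that by auto
    then show ?thesis by (simp add: h_def inner_diff_right)
  qed
  define d where "d v = (v - w) /\<^sub>R (h \<bullet> (v - w))" for v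
  define K where "K = convex hull (d ` (poly_vertices P - {w}))"
  have "compact K" unfolding K_def using finite_poly_vertices[OF P]
    by (simp add: finite_imp_compact_convex_hull)
  then have "K = convex hull {y. y extreme_point_of K}"
    by (intro Krein_Milman_Minkowski) (auto simp: K_def)
  also have "\<dots> \<subseteq> C"
  proof (rule hull_minimal, rule subsetI)
    fix y assume "y \<in> {y. y extreme_point_of K}"
    then obtain u where u: "poly_adj P w u" "u - w = (h \<bullet> (u - w)) *\<^sub>R y" "h \<bullet> (u - w) > 0"
      using vertex_figure_extreme_point[OF P w h, of y] unfolding K_def d_def[abs_def] by auto
    have "y = inverse (h \<bullet> (u - w)) *\<^sub>R ((h \<bullet> (u - w)) *\<^sub>R y)" using u(3) by simp
    also have "\<dots> = inverse (h \<bullet> (u - w)) *\<^sub>R (u - w)" using u(2) by simp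
    also have "\<dots> \<in> C" using u CN by (intro Cs) (auto simp: N_def)
    finally show "y \<in> C" .
  qed (rule Cc)
  finally have KC: "K \<subseteq> C" .
  have "v \<in> (\<lambda>z. z + w) ` C" if v: "v \<in> poly_vertices P" for v
  proof (cases "v = w")
    case False
    have "d v \<in> C" using KC v False unfolding K_def by (auto intro: hull_inc)
    then have "(h \<bullet> (v - w)) *\<^sub>R d v \<in> C" using h[OF v False] by (auto intro: Cs)
    then show ?thesis using h[OF v False] by (auto simp: d_def image_iff intro!: bexI[of _ "v - w"])
  qed (use C0 in auto)
  then have "convex hull (poly_vertices P) \<subseteq> (\<lambda>z. z + w) ` C"
    using convex_translation[OF Cc, of w] by (intro hull_minimal) (auto simp: add.commute)
  then have "x - w \<in> C" using x polytope_eq_hull_vertices[OF P] by auto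
  then show thesis using that unfolding C_def N_def by auto
qed

section \<open>Faces through a vertex and the edges they contain\<close>

definition nbrs :: "'a::euclidean_space set \<Rightarrow> 'a set \<Rightarrow> 'a \<Rightarrow> 'a set" where
  "nbrs P F w = {u. poly_adj P w u \<and> u \<in> F}"

lemma finite_nbrs: "polytope P \<Longrightarrow> finite (nbrs P F w)"
  unfolding nbrs_def using finite_poly_adj[of P w] by simp

lemma face_edge_cone:
  fixes P :: "'a::euclidean_space set"
  assumes "polytope P" "F face_of P" "w \<in> poly_vertices P" "w \<in> F" "x \<in> F"
  obtains c where "\<And>u. c u \<ge> 0" "x - w = (\<Sum>u\<in>nbrs P F w. c u *\<^sub>R (u - w))"
proof -
  have "{u. poly_adj F w u} = nbrs P F w"
    using assms by (auto simp: nbrs_def poly_adj_face)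
  moreover have "polytope F" "w \<in> poly_vertices F"
    using assms face_of_polytope_polytope by (auto simp: poly_vertices_face)
  ultimately show thesis
    using vertex_edge_cone[of F w x] assms(5) that by metis
qed

text \<open>A linear functional that does not increase along the edges of \<open>F\<close> at
  \<open>w\<close> does not increase on the cone they generate, which contains \<open>F\<close> seen
  from \<open>w\<close>.\<close>

lemma face_local_max:
  fixes P :: "'a::euclidean_space set"
  assumes "polytope P" "F face_of P" "w \<in> poly_vertices P" "w \<in> F"
    and le: "\<And>u. u \<in> nbrs P F w \<Longrightarrow> a \<bullet> u \<le> a \<bullet> w" and "x \<in> F"
  shows "a \<bullet> x \<le> a \<bullet> w"
proof -
  obtain c where c: "\<And>u. c u \<ge> 0" "x - w = (\<Sum>u\<in>nbrs P F w. c u *\<^sub>R (u - w))"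
    using face_edge_cone assms by metis
  have "a \<bullet> (x - w) = (\<Sum>u\<in>nbrs P F w. c u * (a \<bullet> u - a \<bullet> w))"
    unfolding c(2) by (simp add: inner_sum_right inner_diff_right)
  also have "\<dots> \<le> 0"
    using le c(1) by (intro sum_nonpos) (simp add: mult_nonneg_nonpos)
  finally show ?thesis by (simp add: inner_diff_right)
qed

lemma face_minus_vertex_subset_span:
  assumes "polytope P" "F face_of P" "w \<in> poly_vertices P" "w \<in> F" "x \<in> F"
  shows "x - w \<in> span ((\<lambda>u. u - w) ` nbrs P F w)"
proof -
  obtain c where "x - w = (\<Sum>u\<in>nbrs P F w. c u *\<^sub>R (u - w))"
    using face_edge_cone[OF assms] by metis
  also have "\<dots> \<in> span ((\<lambda>u. u - w) ` nbrs P F w)"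
    by (intro span_sum span_scale span_base) auto
  finally show ?thesis .
qed

text \<open>The edge directions of \<open>F\<close> at \<open>w\<close> span the directions of
  \<open>F\<close>, and they are all parallel to a hyperplane that cuts \<open>F\<close> out of
  \<open>P\<close>. Hence a face through \<open>w\<close> can be recovered from its neighbours of
  \<open>w\<close>.\<close>

lemma face_eq_span_nbrs:
  assumes "polytope P" "F face_of P" "w \<in> poly_vertices P" "w \<in> F"
  shows "F = {x \<in> P. x - w \<in> span ((\<lambda>u. u - w) ` nbrs P F w)}"
proof
  show "F \<subseteq> {x \<in> P. x - w \<in> span ((\<lambda>u. u - w) ` nbrs P F w)}"
    using face_minus_vertex_subset_span[OF assms] face_of_imp_subset[OF assms(2)] by auto
next
  obtain a b where ab: "F = P \<inter> {x. a \<bullet> x = b}"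
    using face_exposing_functional assms by metis
  have "span ((\<lambda>u. u - w) ` nbrs P F w) \<subseteq> {z. a \<bullet> z = 0}"
    by (rule span_minimal)
      (use ab assms(4) in \<open>auto simp: nbrs_def inner_diff_right subspace_hyperplane\<close>)
  then show "{x \<in> P. x - w \<in> span ((\<lambda>u. u - w) ` nbrs P F w)} \<subseteq> F"
    using ab assms(4) by (auto simp: inner_diff_right)
qed

lemma inj_on_nbrs:
  assumes "polytope P" "w \<in> poly_vertices P"
  shows "inj_on (\<lambda>F. nbrs P F w) {F. F face_of P \<and> w \<in> F}"
proof (rule inj_onI)
  fix F G assume F: "F \<in> {F. F face_of P \<and> w \<in> F}" and G: "G \<in> {F. F face_of P \<and> w \<in> F}"
    and eq: "nbrs P F w = nbrs P G w"
  have "F = {x \<in> P. x - w \<in> span ((\<lambda>u. u - w) ` nbrs P F w)}"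
    using F by (intro face_eq_span_nbrs assms) auto
  also have "\<dots> = G"
    using G unfolding eq by (intro face_eq_span_nbrs[symmetric] assms) auto
  finally show "F = G" .
qed

section \<open>Faces at a simple vertex\<close>

context
  fixes P :: "'a::euclidean_space set" and w :: 'a
  assumes P: "polytope P" and w: "w \<in> poly_vertices P"
    and simple: "int (poly_degree P w) = aff_dim P"
begin

text \<open>The edge directions span the directions of \<open>P\<close>, and at a simple vertex
  there are only as many of them as the dimension.\<close>

lemma simple_vertex_independent: "independent ((\<lambda>u. u - w) ` nbrs P P w)"
proof (rule card_le_dim_spanning)
  let ?N = "nbrs P P w"
  have wP: "w \<in> P" using w poly_vertices_subset by blast
  show "(\<lambda>u. u - w) ` ?N \<subseteq> (\<lambda>x. x - w) ` P" by (auto simp: nbrs_def)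
  show "finite ((\<lambda>u. u - w) ` ?N)" using finite_nbrs[OF P] by simp
  show "(\<lambda>x. x - w) ` P \<subseteq> span ((\<lambda>u. u - w) ` ?N)"
    using face_minus_vertex_subset_span[OF P _ w wP] face_of_refl polytope_imp_convex[OF P] by blast
  have "?N = {u. poly_adj P w u}"
    using poly_vertices_subset by (auto simp: nbrs_def poly_adj_def)
  then have "int (card ?N) = aff_dim P" using simple by (simp add: poly_degree_def)
  also have "\<dots> = int (dim ((\<lambda>x. x - w) ` P))"
    using wP by (intro aff_dim_eq_dim_subtract) (simp add: hull_inc)
  finally show "card ((\<lambda>u. u - w) ` ?N) \<le> dim ((\<lambda>x. x - w) ` P)"
    using card_image_le[OF finite_nbrs[OF P], of "\<lambda>u. u - w" P w] by linarith
qed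

text \<open>The edges of \<open>F\<close> at \<open>w\<close> give a basis of the directions of
  \<open>F\<close>. Consequently all simple vertices of one face have the same degree in it.\<close>

lemma simple_vertex_aff_dim:
  assumes F: "F face_of P" "w \<in> F"
  shows "aff_dim F = int (card (nbrs P F w))"
proof -
  let ?D = "(\<lambda>u. u - w) ` nbrs P F w"
  have "?D \<subseteq> (\<lambda>u. u - w) ` nbrs P P w"
    using face_of_imp_subset[OF F(1)] by (auto simp: nbrs_def)
  then have "independent ?D" using simple_vertex_independent independent_mono by blast
  moreover have "?D \<subseteq> (\<lambda>x. x - w) ` F" by (auto simp: nbrs_def)
  moreover have "(\<lambda>x. x - w) ` F \<subseteq> span ?D"
    using face_minus_vertex_subset_span[OF P F(1) w F(2)] by blast
  ultimately have "card ?D = dim ((\<lambda>x. x - w) ` F)" by (intro basis_card_eq_dim)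
  moreover have "aff_dim F = int (dim ((\<lambda>x. x - w) ` F))"
    using F by (intro aff_dim_eq_dim_subtract) (simp add: hull_inc)
  moreover have "card ?D = card (nbrs P F w)" by (rule card_image) (simp add: inj_on_def)
  ultimately show ?thesis by simp
qed

text \<open>By independence some functional is 0 on the edge directions towards \<open>S\<close> and
  1 on the others. Its minimum over \<open>P\<close> is attained at \<open>w\<close>, and the face
  of minimisers has exactly the neighbours in \<open>S\<close>.\<close>

lemma simple_vertex_face_exists:
  assumes S: "S \<subseteq> nbrs P P w"
  obtains F where "F face_of P" "w \<in> F" "nbrs P F w = S"
proof -
  have wP: "w \<in> P" using w poly_vertices_subset by blast
  obtain f :: "'a \<Rightarrow> real" where f: "linear f"
    "\<And>z. z \<in> (\<lambda>u. u - w) ` nbrs P P w \<Longrightarrow> f z = (if z + w \<in> S then 0 else 1)"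
    using linear_independent_extend[OF simple_vertex_independent, of "\<lambda>z. if z + w \<in> S then 0 else 1"]
    by blast
  \<comment> \<open>The vector that represents the real functional \<open>f\<close> by the inner
    product.\<close>
  define a where "a = adjoint f 1"
  have fa: "f x = a \<bullet> x" for x
    using adjoint_works[OF f(1), of x 1] by (simp add: a_def inner_commute)
  have au: "a \<bullet> u = a \<bullet> w + (if u \<in> S then 0 else 1)" if "u \<in> nbrs P P w" for u
    using f(2)[of "u - w"] that by (auto simp: fa inner_diff_right)
  define F where "F = P \<inter> {x. a \<bullet> x = a \<bullet> w}"
  have "F face_of P"
    unfolding F_def
  proof (rule face_of_Int_supporting_hyperplane_ge)
    show "convex P" using P by (rule polytope_imp_convex)
    then have "P face_of P" by (rule face_of_refl)
    then have "(- a) \<bullet> x \<le> (- a) \<bullet> w" if "x \<in> P" for x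
      by (rule face_local_max[OF P _ w wP]) (auto simp: au that)
    then show "a \<bullet> w \<le> a \<bullet> x" if "x \<in> P" for x using that by simp
  qed
  moreover have "w \<in> F" using wP by (simp add: F_def)
  moreover have "nbrs P F w = S"
    using S au by (auto simp: F_def nbrs_def split: if_splits)
  ultimately show thesis using that by blast
qed

text \<open>Taking neighbours of \<open>w\<close> is a bijection from these faces to the subsets of
  \<open>A\<close>.\<close>

lemma card_faces_nbrs_subset:
  assumes A: "A \<subseteq> nbrs P P w"
  shows "card {F. F face_of P \<and> w \<in> F \<and> nbrs P F w \<subseteq> A} = 2 ^ card A"
proof -
  have "(\<lambda>F. nbrs P F w) ` {F. F face_of P \<and> w \<in> F \<and> nbrs P F w \<subseteq> A} = Pow A"
  proof
    show "Pow A \<subseteq> (\<lambda>F. nbrs P F w) ` {F. F face_of P \<and> w \<in> F \<and> nbrs P F w \<subseteq> A}"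
    proof
      fix S assume "S \<in> Pow A"
      moreover from this A have "S \<subseteq> nbrs P P w" by blast
      then obtain F where "F face_of P" "w \<in> F" "nbrs P F w = S"
        by (rule simple_vertex_face_exists)
      ultimately show "S \<in> (\<lambda>F. nbrs P F w) ` {F. F face_of P \<and> w \<in> F \<and> nbrs P F w \<subseteq> A}" by auto
    qed
  qed auto
  moreover have "inj_on (\<lambda>F. nbrs P F w) {F. F face_of P \<and> w \<in> F \<and> nbrs P F w \<subseteq> A}"
    by (rule inj_on_subset[OF inj_on_nbrs[OF P w]]) auto
  ultimately have "card {F. F face_of P \<and> w \<in> F \<and> nbrs P F w \<subseteq> A} = card (Pow A)"
    using card_image by force
  also have "\<dots> = 2 ^ card A"
    by (simp add: card_Pow finite_subset[OF A finite_nbrs[OF P]])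
  finally show ?thesis .
qed

end

section \<open>Good orientations and the counting of sinks\<close>

definition in_nbrs :: "'a::euclidean_space set \<Rightarrow> ('a \<Rightarrow> real) \<Rightarrow> 'a \<Rightarrow> 'a set" where
  "in_nbrs P r w = {u. poly_adj P w u \<and> r u < r w}"

definition sinks :: "'a::euclidean_space set \<Rightarrow> ('a \<Rightarrow> real) \<Rightarrow> 'a set \<Rightarrow> 'a set" where
  "sinks P r F = {w \<in> poly_vertices P. w \<in> F \<and> nbrs P F w \<subseteq> in_nbrs P r w}"

definition good :: "'a::euclidean_space set \<Rightarrow> ('a \<Rightarrow> real) \<Rightarrow> bool" where
  "good P r \<longleftrightarrow> (\<forall>F. F face_of P \<longrightarrow> F \<noteq> {} \<longrightarrow> card (sinks P r F) = 1)"

text \<open>Kalai's sum of powers of two over in-degrees. The vertex \<open>v0\<close> is left out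
  because the faces with sink \<open>v0\<close> need not be counted by a power of two.\<close>

definition cost :: "'a::euclidean_space set \<Rightarrow> 'a \<Rightarrow> ('a \<Rightarrow> real) \<Rightarrow> nat" where
  "cost P v0 r = (\<Sum>w\<in>poly_vertices P - {v0}. 2 ^ card (in_nbrs P r w))"

text \<open>A ranking stands for the acyclic orientation in which edges point towards larger values;
  \<open>v0\<close> is then a source if \<open>b\<close> holds, and a sink otherwise.\<close>
definition ranking :: "bool \<Rightarrow> 'a::euclidean_space set \<Rightarrow> 'a \<Rightarrow> ('a \<Rightarrow> real) \<Rightarrow> bool" where
  "ranking b P v0 r \<longleftrightarrow> inj_on r (poly_vertices P) \<and>
     (\<forall>u\<in>poly_vertices P - {v0}. if b then r v0 < r u else r u < r v0)"

lemma finite_sinks: "polytope P \<Longrightarrow> finite (sinks P r F)"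
  by (rule finite_subset[OF _ finite_poly_vertices]) (auto simp: sinks_def)

text \<open>The highest vertex of the face is a sink; injectivity makes the comparison with its
  neighbours strict.\<close>

lemma sinks_nonempty:
  assumes P: "polytope P" and r: "inj_on r (poly_vertices P)" and F: "F face_of P" "F \<noteq> {}"
  shows "sinks P r F \<noteq> {}"
proof -
  let ?V = "poly_vertices P \<inter> F"
  have V: "finite ?V" "?V \<noteq> {}"
    using finite_poly_vertices[OF P] face_has_vertex[OF P F] by auto
  then have "Max (r ` ?V) \<in> r ` ?V" by (intro Max_in) auto
  then obtain w where "w \<in> ?V" "Max (r ` ?V) = r w" by blast
  with V(1) have w: "w \<in> ?V" "\<And>u. u \<in> ?V \<Longrightarrow> r u \<le> r w"
    using Max_ge[of "r ` ?V"] by auto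
  have "nbrs P F w \<subseteq> in_nbrs P r w"
  proof
    fix u assume "u \<in> nbrs P F w"
    then have u: "poly_adj P w u" "u \<in> ?V" "u \<noteq> w" by (auto simp: nbrs_def poly_adj_def)
    then have "r u \<noteq> r w" using r w(1) by (auto simp: inj_on_def)
    with u w(2)[of u] show "u \<in> in_nbrs P r w" by (simp add: in_nbrs_def)
  qed
  with w have "w \<in> sinks P r F" by (simp add: sinks_def)
  then show ?thesis by blast
qed

lemma goodI:
  assumes "polytope P" "inj_on r (poly_vertices P)"
    and "\<And>F w w'. F face_of P \<Longrightarrow> w \<in> sinks P r F \<Longrightarrow> w' \<in> sinks P r F \<Longrightarrow> w = w'"
  shows "good P r"
  unfolding good_def
proof (intro allI impI)
  fix F assume F: "F face_of P" "F \<noteq> {}"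
  then obtain w where "w \<in> sinks P r F" using sinks_nonempty assms by blast
  with assms(3)[OF F(1)] have "sinks P r F = {w}" by blast
  then show "card (sinks P r F) = 1" by simp
qed

lemma good_sink_unique:
  assumes "good P r" "F face_of P" "w \<in> sinks P r F" "w' \<in> sinks P r F"
  shows "w = w'"
proof -
  have "F \<noteq> {}" using assms(3) by (auto simp: sinks_def)
  then have "card (sinks P r F) = 1" using assms by (auto simp: good_def)
  then show ?thesis using assms by (auto simp: card_1_singleton_iff)
qed

locale polytope_simple_except =
  fixes P :: "'a::euclidean_space set" and v0 :: 'a
  assumes P: "polytope P" and v0: "v0 \<in> poly_vertices P"
    and simple: "\<And>w. w \<in> poly_vertices P \<Longrightarrow> w \<noteq> v0 \<Longrightarrow> int (poly_degree P w) = aff_dim P"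
begin

text \<open>The number of faces with sink \<open>v0\<close>. A source \<open>v0\<close> is a sink
  only of the face \<open>{v0}\<close>, whereas a sink \<open>v0\<close> is a sink of every face
  through it, so the ranking matters only through \<open>b\<close>.\<close>

definition sink_faces :: "bool \<Rightarrow> nat" where
  "sink_faces b = (if b then 1 else card {F. F face_of P \<and> v0 \<in> F})"

lemma card_faces_sink_v0:
  assumes r: "ranking b P v0 r"
  shows "card {F. F face_of P \<and> v0 \<in> F \<and> nbrs P F v0 \<subseteq> in_nbrs P r v0} = sink_faces b"
proof (cases b)
  case True
  have "in_nbrs P r v0 = {}"
  proof -
    have "r v0 < r u" if "poly_adj P v0 u" for u
      using r True that by (auto simp: ranking_def poly_adj_def)
    then show ?thesis by (force simp: in_nbrs_def)
  qed
  \<comment> \<open>Without neighbours of \<open>v0\<close> in \<open>F\<close>, the directions of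
    \<open>F\<close> lie in the span of the empty set.\<close>
  moreover have "F = {v0}" if F: "F face_of P" "v0 \<in> F" "nbrs P F v0 = {}" for F
  proof -
    have "x = v0" if "x \<in> F" for x
      using face_minus_vertex_subset_span[OF P F(1) v0 F(2) that] F(3) by simp
    then show ?thesis using F(2) by blast
  qed
  moreover have "{v0} face_of P" using v0 by (simp add: poly_vertices_def face_of_singleton)
  moreover have "nbrs P {v0} v0 = {}" by (auto simp: nbrs_def poly_adj_def)
  ultimately have "{F. F face_of P \<and> v0 \<in> F \<and> nbrs P F v0 \<subseteq> in_nbrs P r v0} = {{v0}}"
    by (intro set_eqI iffI) (metis (no_types, lifting) mem_Collect_eq singleton_iff subset_empty,
      metis (no_types, lifting) empty_subsetI mem_Collect_eq singleton_iff)
  then show ?thesis using True by (simp add: sink_faces_def)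
next
  case False
  have "nbrs P F v0 \<subseteq> in_nbrs P r v0" for F
    using r False by (auto simp: in_nbrs_def ranking_def poly_adj_def nbrs_def)
  then show ?thesis using False by (simp add: sink_faces_def)
qed

text \<open>Double counting of the pairs of a face and a sink of it: a simple vertex is a sink of
  exactly the faces whose edges at it all come from in-neighbours, one for each set of
  in-neighbours.\<close>

lemma sum_card_sinks:
  assumes r: "ranking b P v0 r"
  shows "(\<Sum>F | F face_of P \<and> F \<noteq> {}. card (sinks P r F)) = cost P v0 r + sink_faces b"
proof -
  let ?F = "{F. F face_of P \<and> F \<noteq> {}}" and ?V = "poly_vertices P"
  let ?R = "\<lambda>F w. w \<in> F \<and> nbrs P F w \<subseteq> in_nbrs P r w"
  let ?n = "\<lambda>w. card {F. F face_of P \<and> w \<in> F \<and> nbrs P F w \<subseteq> in_nbrs P r w}"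
  have finF: "finite ?F" by (rule finite_subset[OF _ finite_polytope_faces[OF P]]) auto
  have finV: "finite ?V" using P by (rule finite_poly_vertices)
  have "(\<Sum>F\<in>?F. card (sinks P r F)) = (\<Sum>F\<in>?F. \<Sum>w | w \<in> ?V \<and> ?R F w. 1)"
    by (simp add: sinks_def)
  also have "\<dots> = (\<Sum>w\<in>?V. \<Sum>F | F \<in> ?F \<and> ?R F w. 1)"
    by (rule sum.swap_restrict[OF finF finV])
  also have "\<dots> = (\<Sum>w\<in>?V. ?n w)"
    by (intro sum.cong refl) (auto intro!: arg_cong[where f = card])
  also have "\<dots> = ?n v0 + (\<Sum>w\<in>?V - {v0}. ?n w)"
    using finV v0 by (rule sum.remove)
  also have "?n v0 = sink_faces b" by (rule card_faces_sink_v0[OF r])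
  also have "(\<Sum>w\<in>?V - {v0}. ?n w) = cost P v0 r"
    unfolding cost_def
  proof (rule sum.cong[OF refl])
    fix w assume w: "w \<in> ?V - {v0}"
    have "in_nbrs P r w \<subseteq> nbrs P P w"
      using poly_vertices_subset by (auto simp: in_nbrs_def nbrs_def poly_adj_def)
    then show "?n w = 2 ^ card (in_nbrs P r w)"
      using w simple by (intro card_faces_nbrs_subset[OF P]) auto
  qed
  finally show ?thesis by simp
qed

text \<open>Every nonempty face contributes at least 1 to the sum of sink counts, and goodness means
  that each contributes exactly 1. For fixed \<open>b\<close> the bound on \<open>cost\<close> is
  therefore attained by the good rankings alone.\<close>

lemma cost_lower_bound:
  assumes r: "ranking b P v0 r"
  shows "card {F. F face_of P \<and> F \<noteq> {}} \<le> cost P v0 r + sink_faces b"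
    and "good P r \<longleftrightarrow> cost P v0 r + sink_faces b = card {F. F face_of P \<and> F \<noteq> {}}"
proof -
  let ?F = "{F. F face_of P \<and> F \<noteq> {}}"
  have finF: "finite ?F" by (rule finite_subset[OF _ finite_polytope_faces[OF P]]) auto
  have ge: "1 \<le> card (sinks P r F)" if "F \<in> ?F" for F
    using that sinks_nonempty[OF P, of r F] finite_sinks[OF P, of r F] r
    by (auto simp: ranking_def Suc_le_eq card_gt_0_iff)
  have "card ?F \<le> (\<Sum>F\<in>?F. card (sinks P r F))"
    using sum_mono[of ?F "\<lambda>_. 1", OF ge] by simp
  then show "card ?F \<le> cost P v0 r + sink_faces b" using sum_card_sinks[OF r] by simp
  have "good P r \<longleftrightarrow> (\<forall>F\<in>?F. card (sinks P r F) = 1)" by (auto simp: good_def)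
  also have "\<dots> \<longleftrightarrow> (\<Sum>F\<in>?F. card (sinks P r F)) = card ?F"
  proof
    assume "(\<Sum>F\<in>?F. card (sinks P r F)) = card ?F"
    then have "(\<Sum>F\<in>?F. 1) = (\<Sum>F\<in>?F. card (sinks P r F))" by simp
    from sum_mono_inv[OF this ge _ finF] show "\<forall>F\<in>?F. card (sinks P r F) = 1" by simp
  qed simp
  finally show "good P r \<longleftrightarrow> cost P v0 r + sink_faces b = card ?F"
    using sum_card_sinks[OF r] by simp
qed

end

section \<open>Construction of good rankings\<close>

text \<open>The vectors \<open>q\<close> that fail to separate some pair of points lie in finitely
  many hyperplanes, whose union is negligible.\<close>

lemma generic_functional:
  fixes S :: "'a::euclidean_space set"
  assumes "finite S"
  obtains q where "inj_on (\<lambda>x. q \<bullet> x) S"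
proof -
  let ?D = "(\<lambda>(x, y). x - y) ` (S \<times> S) - {0}"
  have "negligible (\<Union>d\<in>?D. {q. d \<bullet> q = 0})"
    using assms by (intro negligible_Union ballI) (auto intro!: negligible_hyperplane)
  then obtain q where q: "q \<notin> (\<Union>d\<in>?D. {q. d \<bullet> q = 0})"
    using non_negligible_UNIV by (metis (no_types, lifting) UNIV_eq_I)
  have "inj_on (\<lambda>x. q \<bullet> x) S"
  proof (rule inj_onI, rule ccontr)
    fix x y assume "x \<in> S" "y \<in> S" "q \<bullet> x = q \<bullet> y" "x \<noteq> y"
    then have "x - y \<in> ?D" "(x - y) \<bullet> q = 0"
      by (auto simp: inner_diff_right inner_commute[of _ q] intro!: rev_image_eqI[of "(x, y)"])
    with q show False by blast
  qed
  then show thesis by (rule that)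
qed

text \<open>For small positive \<epsilon> the strict inequalities of \<alpha> persist, and its ties
  are broken by the injective \<beta>.\<close>

lemma eventually_perturb:
  fixes \<alpha> \<beta> :: "'a \<Rightarrow> real"
  assumes W: "finite W" and \<beta>: "inj_on \<beta> W"
  shows "\<forall>\<^sub>F \<epsilon> in at_right 0. inj_on (\<lambda>u. \<alpha> u + \<epsilon> * \<beta> u) W \<and>
    (\<forall>u\<in>W. \<forall>v\<in>W. \<alpha> u < \<alpha> v \<longrightarrow> \<alpha> u + \<epsilon> * \<beta> u < \<alpha> v + \<epsilon> * \<beta> v)"
proof -
  have lt: "\<forall>\<^sub>F \<epsilon> in at_right 0. \<alpha> u + \<epsilon> * \<beta> u < \<alpha> v + \<epsilon> * \<beta> v" if "\<alpha> u < \<alpha> v" for u v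
  proof -
    have "((\<lambda>\<epsilon>. (\<alpha> v + \<epsilon> * \<beta> v) - (\<alpha> u + \<epsilon> * \<beta> u)) \<longlongrightarrow> (\<alpha> v + 0 * \<beta> v) - (\<alpha> u + 0 * \<beta> u)) (at_right 0)"
      by (intro tendsto_intros)
    from order_tendstoD(1)[OF this, of 0] that show ?thesis by simp
  qed
  have "\<forall>\<^sub>F \<epsilon> in at_right 0. (\<alpha> u < \<alpha> v \<longrightarrow> \<alpha> u + \<epsilon> * \<beta> u < \<alpha> v + \<epsilon> * \<beta> v) \<and>
      (\<alpha> u + \<epsilon> * \<beta> u = \<alpha> v + \<epsilon> * \<beta> v \<longrightarrow> u = v)" if uv: "u \<in> W" "v \<in> W" for u v
  proof (cases "\<alpha> u" "\<alpha> v" rule: linorder_cases)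
    case less
    from lt[OF this] show ?thesis by eventually_elim auto
  next
    case greater
    from lt[OF this] show ?thesis by eventually_elim (use greater in auto)
  next
    case equal
    have "\<forall>\<^sub>F \<epsilon> in at_right 0. (0::real) < \<epsilon>" by (simp add: eventually_at_right_less)
    then show ?thesis
      by eventually_elim (use equal \<beta> uv in \<open>auto simp: inj_on_def\<close>)
  qed
  then have "\<forall>\<^sub>F \<epsilon> in at_right 0. \<forall>u\<in>W. \<forall>v\<in>W. (\<alpha> u < \<alpha> v \<longrightarrow> \<alpha> u + \<epsilon> * \<beta> u < \<alpha> v + \<epsilon> * \<beta> v) \<and>
      (\<alpha> u + \<epsilon> * \<beta> u = \<alpha> v + \<epsilon> * \<beta> v \<longrightarrow> u = v)"
    using W by (intro eventually_ball_finite ballI) auto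
  then show ?thesis by eventually_elim (auto simp: inj_on_def)
qed

text \<open>Any sink of a face is a local and hence a global maximum of the functional there, so two
  sinks have equal values.\<close>

lemma linear_good:
  assumes P: "polytope P" and c: "inj_on (\<lambda>u. c \<bullet> u) (poly_vertices P)"
  shows "good P (\<lambda>u. c \<bullet> u)"
proof (rule goodI[OF P c])
  fix F w w' assume F: "F face_of P" and w: "w \<in> sinks P ((\<bullet>) c) F" "w' \<in> sinks P ((\<bullet>) c) F"
  have "c \<bullet> x \<le> c \<bullet> w" if "w \<in> sinks P ((\<bullet>) c) F" "x \<in> F" for w x
    by (rule face_local_max[OF P F _ _ _ that(2)]) (use that(1) in \<open>auto simp: sinks_def in_nbrs_def\<close>)
  from this[OF w(1), of w'] this[OF w(2), of w] w have "c \<bullet> w = c \<bullet> w'"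
    by (auto simp: sinks_def)
  then show "w = w'" using w c by (auto simp: sinks_def inj_on_def)
qed

text \<open>A linear functional that orders lexicographically: \<open>- a1\<close> puts
  \<open>F\<close> first, \<open>- a2\<close> then puts \<open>v0\<close> first within
  \<open>F\<close>, and a generic \<open>q\<close> separates the rest.\<close>

lemma good_ranking_exists_containing:
  assumes P: "polytope P" and v0: "v0 \<in> poly_vertices P" and F: "F face_of P" "v0 \<in> F"
  obtains r where "ranking True P v0 r" "good P r"
    "\<And>u w. \<lbrakk>u \<in> poly_vertices P; w \<in> poly_vertices P; u \<in> F; w \<notin> F\<rbrakk> \<Longrightarrow> r u < r w"
proof -
  let ?V = "poly_vertices P"
  have finV: "finite ?V" using P by (rule finite_poly_vertices)
  have VP: "?V \<subseteq> P" by (rule poly_vertices_subset)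
  obtain a1 b1 where 1: "\<And>x. x \<in> P \<Longrightarrow> a1 \<bullet> x \<le> b1" "F = P \<inter> {x. a1 \<bullet> x = b1}"
    using face_exposing_functional[OF P F(1)] by metis
  have "{v0} face_of P" using v0 by (simp add: poly_vertices_def face_of_singleton)
  then obtain a2 b2 where 2: "\<And>x. x \<in> P \<Longrightarrow> a2 \<bullet> x \<le> b2" "{v0} = P \<inter> {x. a2 \<bullet> x = b2}"
    using face_exposing_functional[OF P] by metis
  obtain q where q: "inj_on (\<lambda>x. q \<bullet> x) ?V" using generic_functional[OF finV] .
  obtain \<epsilon> where "inj_on (\<lambda>u. - (a2 \<bullet> u) + \<epsilon> * (q \<bullet> u)) ?V \<and>
    (\<forall>u\<in>?V. \<forall>v\<in>?V. - (a2 \<bullet> u) < - (a2 \<bullet> v) \<longrightarrow> - (a2 \<bullet> u) + \<epsilon> * (q \<bullet> u) < - (a2 \<bullet> v) + \<epsilon> * (q \<bullet> v))"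
    using eventually_happens'[OF trivial_limit_at_right_real
        eventually_perturb[OF finV q, of "\<lambda>u. - (a2 \<bullet> u)"]] by blast
  then have e: "inj_on (\<lambda>u. - (a2 \<bullet> u) + \<epsilon> * (q \<bullet> u)) ?V"
    "\<And>u v. \<lbrakk>u \<in> ?V; v \<in> ?V; - (a2 \<bullet> u) < - (a2 \<bullet> v)\<rbrakk> \<Longrightarrow> - (a2 \<bullet> u) + \<epsilon> * (q \<bullet> u) < - (a2 \<bullet> v) + \<epsilon> * (q \<bullet> v)"
    by blast+
  define \<beta> where "\<beta> u = - (a2 \<bullet> u) + \<epsilon> * (q \<bullet> u)" for u
  have \<beta>: "inj_on \<beta> ?V" using e(1) by (simp add: \<beta>_def[abs_def])
  have \<beta>0: "\<beta> v0 < \<beta> u" if "u \<in> ?V" "u \<noteq> v0" for u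
  proof -
    have "u \<in> P" using that VP by blast
    then have "a2 \<bullet> u \<le> b2" "a2 \<bullet> u \<noteq> b2" "a2 \<bullet> v0 = b2" using 2 that by auto
    then show ?thesis unfolding \<beta>_def by (intro e(2) v0 that) auto
  qed
  \<comment> \<open>Positivity of \<delta> matters: on \<open>F\<close>, where \<open>a1\<close> is
    constant, the order is that of \<open>\<delta> * \<beta>\<close>, which must place
    \<open>v0\<close> lowest.\<close>
  obtain \<delta> where "inj_on (\<lambda>u. - (a1 \<bullet> u) + \<delta> * \<beta> u) ?V \<and>
    (\<forall>u\<in>?V. \<forall>v\<in>?V. - (a1 \<bullet> u) < - (a1 \<bullet> v) \<longrightarrow> - (a1 \<bullet> u) + \<delta> * \<beta> u < - (a1 \<bullet> v) + \<delta> * \<beta> v)" "\<delta> > 0"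
    using eventually_happens'[OF trivial_limit_at_right_real eventually_conj[OF
        eventually_perturb[OF finV \<beta>, of "\<lambda>u. - (a1 \<bullet> u)"] eventually_at_right_less]] by blast
  then have d: "inj_on (\<lambda>u. - (a1 \<bullet> u) + \<delta> * \<beta> u) ?V" "\<delta> > 0"
    "\<And>u v. \<lbrakk>u \<in> ?V; v \<in> ?V; - (a1 \<bullet> u) < - (a1 \<bullet> v)\<rbrakk> \<Longrightarrow> - (a1 \<bullet> u) + \<delta> * \<beta> u < - (a1 \<bullet> v) + \<delta> * \<beta> v"
    by blast+
  define c where "c = - a1 - \<delta> *\<^sub>R a2 + (\<delta> * \<epsilon>) *\<^sub>R q"
  have c: "c \<bullet> u = - (a1 \<bullet> u) + \<delta> * \<beta> u" for u
    by (simp add: c_def \<beta>_def inner_diff_left inner_add_left algebra_simps)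
  have inj: "inj_on (\<lambda>u. c \<bullet> u) ?V" using d(1) by (simp add: c)
  have init: "c \<bullet> u < c \<bullet> w" if uw: "u \<in> ?V" "w \<in> ?V" "u \<in> F" "w \<notin> F" for u w
  proof -
    have "w \<in> P" using uw VP by blast
    then have "a1 \<bullet> w \<le> b1" "a1 \<bullet> w \<noteq> b1" "a1 \<bullet> u = b1" using 1 uw by auto
    then show ?thesis unfolding c by (intro d(3) uw) auto
  qed
  have "c \<bullet> v0 < c \<bullet> u" if u: "u \<in> ?V" "u \<noteq> v0" for u
  proof (cases "u \<in> F")
    case True
    then have "a1 \<bullet> u = a1 \<bullet> v0" using 1(2) F(2) by auto
    then show ?thesis using \<beta>0[OF u] d(2) by (simp add: c)
  qed (use init v0 F u in blast)
  then have "ranking True P v0 (\<lambda>u. c \<bullet> u)" using inj by (auto simp: ranking_def)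
  then show thesis using that[of "\<lambda>u. c \<bullet> u"] linear_good[OF P inj] init by blast
qed

text \<open>Rotating a hyperplane that supports \<open>P\<close> along \<open>F\<close> into one that meets \<open>P\<close> only in \<open>v0\<close>
  orders the vertices by the quotient of the two affine functionals, a quasilinear function which
  is minimal on \<open>F\<close> and infinite at \<open>v0\<close>.\<close>
lemma good_ranking_exists_avoiding:
  fixes P :: "'a::euclidean_space set"
  assumes P: "polytope P" and v0: "v0 \<in> poly_vertices P" and F: "F face_of P" "v0 \<notin> F"
  obtains r where "ranking False P v0 r" "good P r"
    "\<And>u w. \<lbrakk>u \<in> poly_vertices P; w \<in> poly_vertices P; u \<in> F; w \<notin> F\<rbrakk> \<Longrightarrow> r u < r w"
proof -
  let ?V = "poly_vertices P" let ?W = "?V - {v0}"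
  have finV: "finite ?V" using P by (rule finite_poly_vertices)
  then have finW: "finite ?W" by simp
  have VP: "?V \<subseteq> P" by (rule poly_vertices_subset)
  obtain a1 b1 where 1: "\<And>x. x \<in> P \<Longrightarrow> a1 \<bullet> x \<le> b1" "F = P \<inter> {x. a1 \<bullet> x = b1}"
    using face_exposing_functional[OF P F(1)] by metis
  have "{v0} face_of P" using v0 by (simp add: poly_vertices_def face_of_singleton)
  then obtain a2 b2 where 2: "\<And>x. x \<in> P \<Longrightarrow> a2 \<bullet> x \<le> b2" "{v0} = P \<inter> {x. a2 \<bullet> x = b2}"
    using face_exposing_functional[OF P] by metis
  define B where "B u = b2 - a2 \<bullet> u" for u
  have Bpos: "B u > 0" if "u \<in> ?W" for u
  proof -
    have "u \<in> P" using that VP by blast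
    then have "a2 \<bullet> u \<le> b2" "a2 \<bullet> u \<noteq> b2" using 2 that by auto
    then show ?thesis unfolding B_def by simp
  qed
  have B0: "B v0 = 0" using 2(2) by (auto simp: B_def)
  \<comment> \<open>A projective transformation: a quotient of an affine function by
    \<open>B\<close> is linear in \<open>z u\<close>. A generic linear functional on the points
    \<open>z u\<close> thus yields an injective quotient \<beta>.\<close>
  define z :: "'a \<Rightarrow> 'a \<times> real" where "z u = inverse (B u) *\<^sub>R (u, 1)" for u
  have zinj: "inj_on z ?W"
  proof (rule inj_onI)
    fix u v assume uv: "u \<in> ?W" "v \<in> ?W" "z u = z v"
    then have "inverse (B u) = inverse (B v)" "inverse (B u) *\<^sub>R u = inverse (B v) *\<^sub>R v"
      by (auto simp: z_def)
    then show "u = v" using Bpos[OF uv(1)] by auto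
  qed
  obtain q where q: "inj_on (\<lambda>x. q \<bullet> x) (z ` ?W)" using generic_functional[of "z ` ?W"] finW by blast
  obtain q1 q2 where q12: "q = (q1, q2)" by (cases q)
  define \<beta> where "\<beta> u = (q1 \<bullet> u + q2) / B u" for u
  have "q \<bullet> z u = \<beta> u" for u
    by (simp add: z_def \<beta>_def q12 field_simps add_divide_distrib)
  then have \<beta>: "inj_on \<beta> ?W"
    using comp_inj_on[OF zinj q] by (simp add: o_def)
  define \<alpha> where "\<alpha> u = (b1 - a1 \<bullet> u) / B u" for u
  have a0: "b1 - a1 \<bullet> v0 > 0"
  proof -
    have "v0 \<in> P" using v0 VP by blast
    then have "a1 \<bullet> v0 \<le> b1" "a1 \<bullet> v0 \<noteq> b1" using 1 F by auto
    then show ?thesis by simp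
  qed
  \<comment> \<open>The perturbed numerator has to stay positive at \<open>v0\<close>, where the
    denominator vanishes; this later excludes other sinks in faces through
    \<open>v0\<close>.\<close>
  have "((\<lambda>\<epsilon>. (b1 - a1 \<bullet> v0) + \<epsilon> * (q1 \<bullet> v0 + q2)) \<longlongrightarrow> (b1 - a1 \<bullet> v0) + 0 * (q1 \<bullet> v0 + q2)) (at_right 0)"
    by (intro tendsto_intros)
  then have "\<forall>\<^sub>F \<epsilon> in at_right 0. (b1 - a1 \<bullet> v0) + \<epsilon> * (q1 \<bullet> v0 + q2) > 0"
    by (rule order_tendstoD(1)) (use a0 in simp)
  from eventually_happens'[OF trivial_limit_at_right_real eventually_conj[OF this eventually_perturb[OF finW \<beta>, of \<alpha>]]]
  obtain \<epsilon> where e0: "(b1 - a1 \<bullet> v0) + \<epsilon> * (q1 \<bullet> v0 + q2) > 0"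
    and e1: "inj_on (\<lambda>u. \<alpha> u + \<epsilon> * \<beta> u) ?W"
    and e2: "\<And>u v. \<lbrakk>u \<in> ?W; v \<in> ?W; \<alpha> u < \<alpha> v\<rbrakk> \<Longrightarrow> \<alpha> u + \<epsilon> * \<beta> u < \<alpha> v + \<epsilon> * \<beta> v"
    by blast
  define A where "A u = (b1 - a1 \<bullet> u) + \<epsilon> * (q1 \<bullet> u + q2)" for u
  have AB: "A u / B u = \<alpha> u + \<epsilon> * \<beta> u" for u
    by (simp add: A_def \<alpha>_def \<beta>_def add_divide_distrib distrib_left)
  \<comment> \<open>As \<open>B v0 = 0\<close>, the quotient at \<open>v0\<close> would be infinite.
    The number chosen instead is merely larger than all other quotients.\<close>
  define r where "r u = (if u = v0 then 1 + (\<Sum>v\<in>?W. \<bar>A v / B v\<bar>) else A u / B u)" for u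
  have r0: "r u < r v0" if "u \<in> ?W" for u
  proof -
    have "A u / B u \<le> \<bar>A u / B u\<bar>" by (rule abs_ge_self)
    also have "\<dots> \<le> (\<Sum>v\<in>?W. \<bar>A v / B v\<bar>)" using finW that by (intro member_le_sum) auto
    finally show ?thesis using that by (simp add: r_def)
  qed
  have inj: "inj_on r ?V"
  proof (rule inj_onI, rule ccontr)
    fix u v assume uv: "u \<in> ?V" "v \<in> ?V" "r u = r v" "u \<noteq> v"
    then have "u \<in> ?W" "v \<in> ?W" using r0[of u] r0[of v] by auto
    then show False using e1 uv by (auto simp: inj_on_def r_def AB)
  qed
  have init: "r u < r w" if uw: "u \<in> ?V" "w \<in> ?V" "u \<in> F" "w \<notin> F" for u w
  proof -
    have uW: "u \<in> ?W" using uw F by auto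
    show ?thesis
    proof (cases "w = v0")
      case False
      then have wW: "w \<in> ?W" using uw by auto
      have "w \<in> P" using uw VP by blast
      then have "a1 \<bullet> w < b1" "a1 \<bullet> u = b1" using 1 uw by (auto simp: order_less_le)
      then have "\<alpha> u < \<alpha> w" using Bpos[OF wW] by (simp add: \<alpha>_def)
      from e2[OF uW wW this] show ?thesis using uW wW by (simp add: r_def AB)
    qed (use r0 uW in simp)
  qed
  \<comment> \<open>With \<open>t\<close> the quotient at \<open>w\<close>, the affine function A -
    t B vanishes at \<open>w\<close> and is at most 0 at the neighbours of \<open>w\<close> in
    \<open>G\<close>; none of them is \<open>v0\<close>, which has the top rank. So \<open>w\<close>
    maximises it over \<open>G\<close>.\<close>
  have sink: "A x \<le> A w / B w * B x" if G: "G face_of P" "w \<in> sinks P r G" "w \<noteq> v0" "x \<in> G" for G w x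
  proof -
    define t where "t = A w / B w"
    have w: "w \<in> ?W" "w \<in> G" "nbrs P G w \<subseteq> in_nbrs P r w" using G by (auto simp: sinks_def)
    define m where "m = - a1 + \<epsilon> *\<^sub>R q1 + t *\<^sub>R a2"
    have m: "A y - t * B y = m \<bullet> y + (b1 + \<epsilon> * q2 - t * b2)" for y
      by (simp add: A_def B_def m_def inner_diff_left inner_add_left algebra_simps)
    have mw: "A w - t * B w = 0" using Bpos[OF w(1)] by (simp add: t_def)
    have "m \<bullet> x \<le> m \<bullet> w"
    proof (rule face_local_max[OF P G(1) _ w(2) _ G(4)])
      fix u assume "u \<in> nbrs P G w"
      then have "u \<in> ?V" "r u < r w" using w(3) by (auto simp: in_nbrs_def poly_adj_def)
      moreover from this have uW: "u \<in> ?W" using r0[OF w(1)] by auto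
      ultimately have "A u / B u < t" using w(1) by (simp add: r_def t_def)
      then have "A u - t * B u \<le> 0" using Bpos[OF uW] by (simp add: field_simps)
      then show "m \<bullet> u \<le> m \<bullet> w" using m[of u] m[of w] mw by simp
    qed (use w in auto)
    then show ?thesis using m[of x] m[of w] mw by (simp add: t_def)
  qed
  have "good P r"
  proof (rule goodI[OF P inj])
    fix G w w' assume G: "G face_of P" and w: "w \<in> sinks P r G" "w' \<in> sinks P r G"
    show "w = w'"
    proof (cases "v0 \<in> G")
      case True
      have "w = v0" if "w \<in> sinks P r G" for w
      proof (rule ccontr)
        assume "w \<noteq> v0"
        \<comment> \<open>At \<open>v0\<close> the inequality reads A \<le> 0, contrary to the
          choice of \<epsilon>.\<close>
        from sink[OF G that this True] B0 e0 show False by (simp add: A_def)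
      qed
      with w show ?thesis by auto
    next
      case False
      have le: "r x \<le> r w" if "w \<in> sinks P r G" "x \<in> sinks P r G" for w x
      proof -
        have *: "w \<in> ?W" "x \<in> ?W" "x \<in> G" using that False by (auto simp: sinks_def)
        then have "A x \<le> A w / B w * B x" using sink[OF G that(1)] by auto
        then show ?thesis using * Bpos[OF *(2)] by (simp add: r_def pos_divide_le_eq)
      qed
      from le[OF w] le[OF w(2,1)] have "r w = r w'" by simp
      then show ?thesis using inj w by (auto simp: sinks_def inj_on_def)
    qed
  qed
  moreover have "ranking False P v0 r" using inj r0 by (auto simp: ranking_def)
  ultimately show thesis using that init by blast
qed

section \<open>Transport of rankings along a graph isomorphism\<close>

definition graph_isomorphism ::
    "('a \<Rightarrow> 'b) \<Rightarrow> 'a::euclidean_space set \<Rightarrow> 'b::euclidean_space set \<Rightarrow> bool" where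
  "graph_isomorphism g P Q \<longleftrightarrow> bij_betw g (poly_vertices P) (poly_vertices Q) \<and>
     (\<forall>u\<in>poly_vertices P. \<forall>v\<in>poly_vertices P. poly_adj P u v \<longleftrightarrow> poly_adj Q (g u) (g v))"

lemma graph_isomorphism_inv_into:
  assumes "graph_isomorphism g P Q"
  shows "graph_isomorphism (inv_into (poly_vertices P) g) Q P"
proof -
  let ?h = "inv_into (poly_vertices P) g"
  have g: "bij_betw g (poly_vertices P) (poly_vertices Q)"
    using assms by (simp add: graph_isomorphism_def)
  have h: "?h v \<in> poly_vertices P" "g (?h v) = v" if "v \<in> poly_vertices Q" for v
    using that g by (auto simp: bij_betw_def inv_into_into f_inv_into_f)
  have "poly_adj Q u v \<longleftrightarrow> poly_adj P (?h u) (?h v)"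
    if "u \<in> poly_vertices Q" "v \<in> poly_vertices Q" for u v
    using assms h[OF that(1)] h[OF that(2)] by (auto simp: graph_isomorphism_def)
  then show ?thesis using g by (simp add: graph_isomorphism_def bij_betw_inv_into)
qed

lemma graph_isomorphism_adj_image:
  assumes g: "graph_isomorphism g P Q" and w: "w \<in> poly_vertices P"
  shows "{v. poly_adj Q (g w) v} = g ` {u. poly_adj P w u}"
proof
  show "g ` {u. poly_adj P w u} \<subseteq> {v. poly_adj Q (g w) v}"
    using g by (auto simp: graph_isomorphism_def dest: poly_adjD)
  show "{v. poly_adj Q (g w) v} \<subseteq> g ` {u. poly_adj P w u}"
  proof
    fix v assume v: "v \<in> {v. poly_adj Q (g w) v}"
    then have "v \<in> poly_vertices Q" by (simp add: poly_adj_def)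
    then have "v \<in> g ` poly_vertices P"
      using g by (simp add: graph_isomorphism_def bij_betw_def)
    then obtain u where "u \<in> poly_vertices P" "v = g u" by blast
    then show "v \<in> g ` {u. poly_adj P w u}"
      using g v w by (auto simp: graph_isomorphism_def)
  qed
qed

lemma graph_isomorphism_inj_adj:
  assumes "graph_isomorphism g P Q" "A \<subseteq> {u. poly_adj P w u}"
  shows "inj_on g A"
  by (rule inj_on_subset[of g "poly_vertices P"])
    (use assms in \<open>auto simp: graph_isomorphism_def bij_betw_def poly_adj_def\<close>)

lemma graph_isomorphism_degree:
  assumes "graph_isomorphism g P Q" "w \<in> poly_vertices P"
  shows "poly_degree Q (g w) = poly_degree P w"
  using graph_isomorphism_adj_image[OF assms] graph_isomorphism_inj_adj[OF assms(1) subset_refl]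
  by (simp add: poly_degree_def card_image)

text \<open>In-degrees are determined by the graph and the ranking. Relating \<open>r\<close> and
  \<open>s\<close> by an equation on vertices allows both pushing a ranking forward and pulling one
  back.\<close>

lemma cost_graph_isomorphism:
  assumes g: "graph_isomorphism g P Q" and v0: "v0 \<in> poly_vertices P"
    and s: "\<And>u. u \<in> poly_vertices P \<Longrightarrow> s (g u) = r u"
  shows "cost Q (g v0) s = cost P v0 r"
proof -
  have bij: "bij_betw g (poly_vertices P - {v0}) (poly_vertices Q - {g v0})"
    using g v0 by (auto simp: graph_isomorphism_def bij_betw_def inj_on_def)
  have card_in: "card (in_nbrs Q s (g w)) = card (in_nbrs P r w)" if w: "w \<in> poly_vertices P" for w
  proof -
    have "in_nbrs Q s (g w) = {v \<in> {v. poly_adj Q (g w) v}. s v < s (g w)}" by (auto simp: in_nbrs_def)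
    also have "\<dots> = g ` {u \<in> {u. poly_adj P w u}. s (g u) < s (g w)}"
      unfolding graph_isomorphism_adj_image[OF g w] by blast
    also have "{u \<in> {u. poly_adj P w u}. s (g u) < s (g w)} = in_nbrs P r w"
      using s[OF w] s poly_adjD(2)[of P w] by (auto simp: in_nbrs_def)
    finally have "in_nbrs Q s (g w) = g ` in_nbrs P r w" .
    moreover have "inj_on g (in_nbrs P r w)"
      by (rule graph_isomorphism_inj_adj[OF g]) (auto simp: in_nbrs_def)
    ultimately show ?thesis by (simp add: card_image)
  qed
  have "cost Q (g v0) s = (\<Sum>w\<in>poly_vertices P - {v0}. 2 ^ card (in_nbrs Q s (g w)))"
    unfolding cost_def by (rule sum.reindex_bij_betw[OF bij, symmetric])
  also have "\<dots> = cost P v0 r" unfolding cost_def using card_in by (intro sum.cong refl) auto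
  finally show ?thesis .
qed

lemma ranking_graph_isomorphism:
  assumes g: "graph_isomorphism g P Q" and v0: "v0 \<in> poly_vertices P"
    and s: "\<And>u. u \<in> poly_vertices P \<Longrightarrow> s (g u) = r u"
  shows "ranking b Q (g v0) s \<longleftrightarrow> ranking b P v0 r"
proof -
  have V: "poly_vertices Q = g ` poly_vertices P" and inj: "inj_on g (poly_vertices P)"
    using g by (auto simp: graph_isomorphism_def bij_betw_def)
  have "inj_on s (poly_vertices Q) \<longleftrightarrow> inj_on r (poly_vertices P)"
    unfolding V comp_inj_on_iff[OF inj] using s by (intro inj_on_cong) simp
  moreover have "poly_vertices Q - {g v0} = g ` (poly_vertices P - {v0})"
    unfolding V using inj v0 by (auto simp: inj_on_def)
  moreover have "(if b then s (g v0) < s (g u) else s (g u) < s (g v0)) \<longleftrightarrow>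
      (if b then r v0 < r u else r u < r v0)" if "u \<in> poly_vertices P - {v0}" for u
    using s[OF v0] s[of u] that by auto
  ultimately show ?thesis unfolding ranking_def by simp
qed

lemma good_ranking_exists:
  assumes P: "polytope P" and v0: "v0 \<in> poly_vertices P"
  obtains r where "ranking b P v0 r" "good P r"
proof (cases b)
  case True
  have "{v0} face_of P" using v0 by (simp add: poly_vertices_def face_of_singleton)
  then obtain r where "ranking True P v0 r" "good P r"
    using good_ranking_exists_containing[OF P v0] by blast
  with that True show thesis by simp
next
  case False
  \<comment> \<open>The empty face serves as a face that avoids \<open>v0\<close>.\<close>
  obtain r where "ranking False P v0 r" "good P r"
    by (rule good_ranking_exists_avoiding[OF P v0 empty_face_of]) auto
  with that False show thesis by simp
qed

text \<open>Some good \<open>s'\<close> of the same class exists on \<open>Q\<close>. Pulled back to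
  \<open>P\<close> it costs at least as much as the good \<open>r\<close>, so \<open>s\<close> costs
  at most as much as \<open>s'\<close>, which attains the lower bound on \<open>Q\<close>. Costs are
  compared only within one polytope, so the face numbers of \<open>P\<close> and \<open>Q\<close>
  never have to be matched.\<close>

lemma good_graph_isomorphism:
  assumes PP: "polytope_simple_except P v0" and QQ: "polytope_simple_except Q (g v0)"
    and g: "graph_isomorphism g P Q"
    and s: "\<And>u. u \<in> poly_vertices P \<Longrightarrow> s (g u) = r u"
    and r: "ranking b P v0 r" "good P r"
  shows "good Q s"
proof -
  interpret P: polytope_simple_except P v0 by (rule PP)
  interpret Q: polytope_simple_except Q "g v0" by (rule QQ)
  obtain s' where s': "ranking b Q (g v0) s'" "good Q s'"
    using good_ranking_exists[OF Q.P Q.v0] .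
  have rs: "ranking b Q (g v0) s" using r ranking_graph_isomorphism[of g P Q v0 s r, OF g P.v0 s] by blast
  have rs': "ranking b P v0 (s' \<circ> g)"
    using s'(1) ranking_graph_isomorphism[OF g P.v0, of s' "s' \<circ> g"] by simp
  have "cost P v0 r \<le> cost P v0 (s' \<circ> g)"
    using P.cost_lower_bound(1)[OF rs'] P.cost_lower_bound(2)[OF r(1)] r(2) by linarith
  then have "cost Q (g v0) s \<le> cost Q (g v0) s'"
    using cost_graph_isomorphism[of g P Q v0 s r, OF g P.v0 s]
      cost_graph_isomorphism[OF g P.v0, of s' "s' \<circ> g"] by simp
  then show ?thesis
    using Q.cost_lower_bound(1)[OF rs] Q.cost_lower_bound(2)[OF rs] Q.cost_lower_bound(2)[OF s'(1)] s'(2) by linarith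
qed

section \<open>Transfer of faces\<close>

lemma face_graph_isomorphism:
  fixes P :: "'a::euclidean_space set" and Q :: "'b::euclidean_space set"
  assumes PP: "polytope_simple_except P v0" and QQ: "polytope_simple_except Q (g v0)"
    and g: "graph_isomorphism g P Q" and F: "F face_of P"
  obtains F' where "F' face_of Q" "poly_vertices Q \<inter> F' = g ` (poly_vertices P \<inter> F)"
proof (cases "F = {}")
  case True
  with that[of "{}"] show thesis by simp
next
  case False
  interpret P: polytope_simple_except P v0 by (rule PP)
  interpret Q: polytope_simple_except Q "g v0" by (rule QQ)
  have bij: "bij_betw g (poly_vertices P) (poly_vertices Q)"
    using g by (simp add: graph_isomorphism_def)
  then have gV: "poly_vertices Q = g ` poly_vertices P" and inj: "inj_on g (poly_vertices P)"
    by (auto simp: bij_betw_def)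
  \<comment> \<open>The orientation class is chosen so that no ascending edge inside
    \<open>F\<close> ends in \<open>v0\<close>.\<close>
  define b where "b \<longleftrightarrow> v0 \<in> F"
  obtain r where r: "ranking b P v0 r" "good P r" and
    init: "\<And>u w. \<lbrakk>u \<in> poly_vertices P; w \<in> poly_vertices P; u \<in> F; w \<notin> F\<rbrakk> \<Longrightarrow> r u < r w"
    using good_ranking_exists_containing[OF P.P P.v0 F] good_ranking_exists_avoiding[OF P.P P.v0 F]
    unfolding b_def by metis
  define s where "s = r \<circ> inv_into (poly_vertices P) g"
  have s: "s (g u) = r u" if "u \<in> poly_vertices P" for u
    using that inj by (simp add: s_def)
  have goodQ: "good Q s" by (rule good_graph_isomorphism[of P v0 Q g s r, OF PP QQ g s r])
  have rs: "ranking b Q (g v0) s" using r ranking_graph_isomorphism[of g P Q v0 s r, OF g P.v0 s] by blast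
  obtain x where x: "x \<in> sinks P r F"
    using sinks_nonempty[OF P.P _ F False] r by (auto simp: ranking_def)
  then have xV: "x \<in> poly_vertices P" "x \<in> F" by (auto simp: sinks_def)
  \<comment> \<open>A vertex of \<open>F\<close> other than the unique sink \<open>x\<close> has an
    ascending edge in \<open>F\<close>. It does not lead to \<open>v0\<close>, which is the lowest
    vertex if it lies in \<open>F\<close>.\<close>
  have up: "\<exists>u. u \<in> nbrs P F w \<and> r w < r u \<and> u \<noteq> v0"
    if w: "w \<in> poly_vertices P" "w \<in> F" "w \<noteq> x" for w
  proof -
    have "w \<notin> sinks P r F" using good_sink_unique[OF r(2) F x] w(3) by blast
    then obtain u where u: "u \<in> nbrs P F w" "u \<notin> in_nbrs P r w" using w by (auto simp: sinks_def)
    then have uw: "poly_adj P u w" "u \<in> poly_vertices P" "u \<noteq> w" "u \<in> F"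
      by (auto simp: nbrs_def poly_adj_def)
    then have "r u \<noteq> r w" using r(1) w(1) by (auto simp: ranking_def inj_on_def)
    then have "r w < r u" using u uw poly_adj_sym[of P u w] by (auto simp: in_nbrs_def)
    moreover have "u \<noteq> v0"
      using calculation r(1) uw w(1) by (auto simp: ranking_def b_def dest: bspec[of _ _ w])
    ultimately show ?thesis using u by blast
  qed
  have le_x: "r w \<le> r x" if "w \<in> poly_vertices P" "w \<in> F" for w
  proof -
    let ?A = "poly_vertices P \<inter> F"
    have "finite ?A" using finite_poly_vertices[OF P.P] by simp
    then have "Max (r ` ?A) \<in> r ` ?A" using that by (intro Max_in) auto
    then obtain m where m: "m \<in> ?A" "Max (r ` ?A) = r m" by blast
    then have le: "r u \<le> r m" if "u \<in> ?A" for u using \<open>finite ?A\<close> that Max_ge[of "r ` ?A"] by auto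
    have "m = x"
    proof (rule ccontr)
      assume "m \<noteq> x"
      then obtain u where "u \<in> nbrs P F m" "r m < r u" using up m(1) by blast
      moreover from this have "u \<in> ?A" by (auto simp: nbrs_def poly_adj_def)
      ultimately show False using le by force
    qed
    then show ?thesis using le that by auto
  qed
  show thesis
  proof (cases "x = v0")
    \<comment> \<open>Here \<open>v0\<close> is both the lowest and the highest vertex of
      \<open>F\<close>, so \<open>F\<close> is the single vertex \<open>v0\<close>.\<close>
    case True
    have "w = v0" if w: "w \<in> poly_vertices P" "w \<in> F" for w
    proof (rule ccontr)
      assume "w \<noteq> v0"
      then have "r v0 < r w" using r(1) w(1) xV(2) True by (simp add: ranking_def b_def)
      then show False using le_x[OF w] True by simp
    qed
    then have "poly_vertices P \<inter> F = {v0}" using True xV by auto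
    moreover have "{g v0} face_of Q"
      using Q.v0 by (simp add: poly_vertices_def face_of_singleton)
    ultimately show thesis using that[of "{g v0}"] Q.v0 by auto
  next
    case False
    \<comment> \<open>The common degree in \<open>F\<close> of its simple vertices, that is, the
      dimension of \<open>F\<close>. The face \<open>F'\<close> below inherits this number through
      the edges at \<open>g x\<close>.\<close>
    define k where "k = card (nbrs P F x)"
    have k: "card (nbrs P F w) = k" if "w \<in> poly_vertices P" "w \<in> F" "w \<noteq> v0" for w
      using simple_vertex_aff_dim[OF P.P that(1) P.simple[OF that(1,3)] F that(2)]
        simple_vertex_aff_dim[OF P.P xV(1) P.simple[OF xV(1) False] F xV(2)] by (simp add: k_def)
    have gx: "g x \<in> poly_vertices Q" "g x \<noteq> g v0"
      using xV False gV inj P.v0 by (auto simp: inj_on_def)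
    have "g ` nbrs P F x \<subseteq> g ` {u. poly_adj P x u}" by (auto simp: nbrs_def)
    also have "\<dots> \<subseteq> nbrs Q Q (g x)"
      unfolding graph_isomorphism_adj_image[OF g xV(1), symmetric]
      using poly_vertices_subset[of Q] by (auto simp: nbrs_def dest: poly_adjD(2))
    finally obtain F' where F': "F' face_of Q" "g x \<in> F'" "nbrs Q F' (g x) = g ` nbrs P F x"
      using simple_vertex_face_exists[OF Q.P gx(1) Q.simple[OF gx]] by metis
    have card_g: "card (g ` nbrs P F w) = card (nbrs P F w)" for w
      by (rule card_image[OF graph_isomorphism_inj_adj[OF g]]) (auto simp: nbrs_def)
    have k': "card (nbrs Q F' y) = k" if "y \<in> poly_vertices Q" "y \<in> F'" "y \<noteq> g v0" for y
      using simple_vertex_aff_dim[OF Q.P that(1) Q.simple[OF that(1,3)] F'(1) that(2)]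
        simple_vertex_aff_dim[OF Q.P gx(1) Q.simple[OF gx] F'(1,2)] F'(3)
      by (simp add: k_def card_g)
    have gx_sink: "g x \<in> sinks Q s F'"
    proof -
      have "v \<in> in_nbrs Q s (g x)" if v: "v \<in> nbrs Q F' (g x)" for v
      proof -
        obtain u where u: "u \<in> nbrs P F x" "v = g u" using v F'(3) by auto
        then have "poly_adj P x u" "r u < r x" "u \<in> poly_vertices P"
          using x by (auto simp: sinks_def in_nbrs_def nbrs_def poly_adj_def)
        then show ?thesis using u v s xV by (auto simp: in_nbrs_def nbrs_def)
      qed
      then show ?thesis using gx F' by (auto simp: sinks_def)
    qed
    \<comment> \<open>The highest vertex of \<open>F'\<close> is a sink of it and so equals
      \<open>g x\<close>, because \<open>s\<close> is good. All vertices of \<open>F'\<close> are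
      thus ranked at most as high as \<open>x\<close>, and \<open>F\<close> is initial.\<close>
    have sub: "poly_vertices Q \<inter> F' \<subseteq> g ` (poly_vertices P \<inter> F)"
    proof
      fix y assume y: "y \<in> poly_vertices Q \<inter> F'"
      let ?A = "poly_vertices Q \<inter> F'"
      have "finite ?A" using finite_poly_vertices[OF Q.P] by simp
      then have "Max (s ` ?A) \<in> s ` ?A" using y by (intro Max_in) auto
      then obtain m where m: "m \<in> ?A" "Max (s ` ?A) = s m" by blast
      then have le: "s u \<le> s m" if "u \<in> ?A" for u
        using \<open>finite ?A\<close> that Max_ge[of "s ` ?A"] by auto
      have "m \<in> sinks Q s F'"
      proof -
        have "u \<in> in_nbrs Q s m" if u: "u \<in> nbrs Q F' m" for u
        proof -
          have "u \<in> ?A" "u \<noteq> m" using u by (auto simp: nbrs_def poly_adj_def)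
          moreover from this have "s u \<noteq> s m" using rs m(1) by (auto simp: ranking_def inj_on_def)
          ultimately show ?thesis using le[of u] u by (auto simp: nbrs_def in_nbrs_def)
        qed
        then show ?thesis using m by (auto simp: sinks_def)
      qed
      then have "m = g x" using good_sink_unique[OF goodQ F'(1) gx_sink] by simp
      obtain u where u: "u \<in> poly_vertices P" "y = g u" using y gV by auto
      then have "r u \<le> r x" using le[OF y] \<open>m = g x\<close> s xV by auto
      then have "u \<in> F" using init[OF xV(1) u(1) xV(2)] by force
      then show "y \<in> g ` (poly_vertices P \<inter> F)" using u by auto
    qed
    \<comment> \<open>By \<open>sub\<close> the neighbours in \<open>F'\<close> come from neighbours
      in \<open>F\<close>; both sets have \<open>k\<close> elements.\<close>
    have nbrs_eq: "nbrs Q F' (g w) = g ` nbrs P F w"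
      if w: "w \<in> poly_vertices P" "w \<in> F" "w \<noteq> v0" "g w \<in> F'" for w
    proof (rule card_subset_eq)
      show "finite (g ` nbrs P F w)" using finite_nbrs[OF P.P] by simp
      show "nbrs Q F' (g w) \<subseteq> g ` nbrs P F w"
      proof
        fix v assume v: "v \<in> nbrs Q F' (g w)"
        then have "v \<in> {v. poly_adj Q (g w) v}" by (simp add: nbrs_def)
        then obtain u where u: "poly_adj P w u" "v = g u"
          using graph_isomorphism_adj_image[OF g w(1)] by auto
        have "v \<in> poly_vertices Q \<inter> F'" using v by (auto simp: nbrs_def poly_adj_def)
        then obtain u' where "u' \<in> poly_vertices P" "u' \<in> F" "v = g u'" using sub by auto
        moreover have "u \<in> poly_vertices P" using u by (simp add: poly_adj_def)
        ultimately have "u \<in> F" using u(2) inj by (auto simp: inj_on_def)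
        with u show "v \<in> g ` nbrs P F w" by (auto simp: nbrs_def)
      qed
      have "g w \<in> poly_vertices Q" "g w \<noteq> g v0"
        using w gV inj P.v0 by (auto simp: inj_on_def)
      with w show "card (nbrs Q F' (g w)) = card (g ` nbrs P F w)"
        by (simp add: card_g k k')
    qed
    \<comment> \<open>Induction from the top down: \<open>w\<close> has a higher neighbour
      \<open>u\<close> in \<open>F\<close> other than \<open>v0\<close>, and once \<open>g u\<close>
      is in \<open>F'\<close>, all neighbours of \<open>u\<close> in \<open>F\<close> are mapped
      into \<open>F'\<close>.\<close>
    have "g w \<in> F'" if "w \<in> poly_vertices P" "w \<in> F" for w
      using that
    proof (induction "card {u \<in> poly_vertices P. r w < r u}" arbitrary: w rule: less_induct)
      case less
      show ?case
      proof (cases "w = x")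
        case False
        then obtain u where u: "u \<in> nbrs P F w" "r w < r u" "u \<noteq> v0" using up less.prems by blast
        then have uV: "u \<in> poly_vertices P" "u \<in> F" "w \<in> nbrs P F u"
          using less.prems poly_adj_sym[of P u w] by (auto simp: nbrs_def poly_adj_def)
        have "{v \<in> poly_vertices P. r u < r v} \<subset> {v \<in> poly_vertices P. r w < r v}"
          using u(2) uV(1) by auto
        then have "card {v \<in> poly_vertices P. r u < r v} < card {v \<in> poly_vertices P. r w < r v}"
          using finite_poly_vertices[OF P.P] by (intro psubset_card_mono) auto
        then have "g u \<in> F'" using less.hyps uV by blast
        then have "g w \<in> nbrs Q F' (g u)" using nbrs_eq uV u by blast
        then show ?thesis by (simp add: nbrs_def)
      qed (use F' in simp)
    qed
    then have "poly_vertices Q \<inter> F' = g ` (poly_vertices P \<inter> F)"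
      using sub gV by auto
    with that F' show thesis by blast
  qed
qed

section \<open>Recognising the nonsimple vertex\<close>

text \<open>Such a polytope is a segment, and both of its ends are simple. This covers the case
  below in which no third vertex is available.\<close>

lemma two_vertices_degree:
  assumes P: "polytope P" and V: "poly_vertices P = {v, w}" "v \<noteq> w"
  shows "int (poly_degree P v) = aff_dim P"
proof -
  have "P = convex hull {v, w}" using polytope_eq_hull_vertices[OF P] V by simp
  then have dim: "aff_dim P = 1" using V(2) by (metis aff_dim_2 aff_dim_convex_hull)
  have "P face_of P" using P by (simp add: face_of_refl polytope_imp_convex)
  then have "{u. poly_adj P v u} = {w}"
    using V dim poly_vertices_subset[of P] by (auto simp: poly_adj_def)
  then show ?thesis using dim by (simp add: poly_degree_def)
qed

lemma nearly_simple_1E: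
  assumes "nearly_simple 1 P"
  obtains v0 where "polytope_simple_except P v0" "int (poly_degree P v0) \<noteq> aff_dim P"
proof -
  obtain v0 where v0: "{v \<in> poly_vertices P. int (poly_degree P v) \<noteq> aff_dim P} = {v0}"
    using assms by (auto simp: nearly_simple_def card_1_singleton_iff)
  then have "polytope_simple_except P v0"
    using assms by (unfold_locales) (auto simp: nearly_simple_def)
  with that v0 show thesis by blast
qed

text \<open>Otherwise a third vertex, simple in both polytopes, shows that the dimensions agree.
  Then \<open>g v0\<close>, simple in \<open>Q\<close>, has the degree that would make
  \<open>v0\<close> simple in \<open>P\<close>.\<close>

lemma nonsimple_vertex_graph_isomorphism:
  assumes PP: "polytope_simple_except P v0" "int (poly_degree P v0) \<noteq> aff_dim P"
    and QQ: "polytope_simple_except Q q0" "int (poly_degree Q q0) \<noteq> aff_dim Q"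
    and g: "graph_isomorphism g P Q"
  shows "g v0 = q0"
proof (rule ccontr)
  assume ne: "g v0 \<noteq> q0"
  interpret P: polytope_simple_except P v0 by fact
  interpret Q: polytope_simple_except Q q0 by fact
  have gV: "poly_vertices Q = g ` poly_vertices P"
    using g by (auto simp: graph_isomorphism_def bij_betw_def)
  then obtain p where p: "p \<in> poly_vertices P" "q0 = g p" using Q.v0 by auto
  have "poly_vertices P = {v0, p}"
  proof (rule ccontr)
    assume "poly_vertices P \<noteq> {v0, p}"
    then obtain w where w: "w \<in> poly_vertices P" "w \<noteq> v0" "w \<noteq> p" using P.v0 p by blast
    then have "g w \<noteq> q0" using p g by (auto simp: graph_isomorphism_def bij_betw_def inj_on_def)
    then have "aff_dim P = aff_dim Q"
      using P.simple[OF w(1,2)] Q.simple[of "g w"] w gV graph_isomorphism_degree[OF g w(1)] by auto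
    moreover have "aff_dim Q = int (poly_degree P v0)"
      using Q.simple[of "g v0"] ne P.v0 gV graph_isomorphism_degree[OF g P.v0] by auto
    ultimately show False using PP by simp
  qed
  then show False using two_vertices_degree[OF P.P, of v0 p] PP ne p by auto
qed

section \<open>The isomorphism of face lattices\<close>

theorem theorem2p18:
  fixes P :: "'a::euclidean_space set" and Q :: "'b::euclidean_space set"
  assumes "nearly_simple 1 P"
    and "nearly_simple 1 Q"
    and "graph_iso P Q"
  shows "face_lattice_iso P Q"
proof -
  obtain v0 where PP: "polytope_simple_except P v0" "int (poly_degree P v0) \<noteq> aff_dim P"
    using nearly_simple_1E[OF assms(1)] .
  obtain q0 where QQ: "polytope_simple_except Q q0" "int (poly_degree Q q0) \<noteq> aff_dim Q"
    using nearly_simple_1E[OF assms(2)] .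
  interpret P: polytope_simple_except P v0 by fact
  interpret Q: polytope_simple_except Q q0 by fact
  obtain g where g: "graph_isomorphism g P Q"
    using assms(3) by (auto simp: graph_iso_def graph_isomorphism_def)
  have gv0: "g v0 = q0" using nonsimple_vertex_graph_isomorphism[OF PP QQ g] .
  define h where "h = inv_into (poly_vertices P) g"
  have h: "graph_isomorphism h Q P"
    unfolding h_def by (rule graph_isomorphism_inv_into[OF g])
  have gV: "poly_vertices Q = g ` poly_vertices P" and inj: "inj_on g (poly_vertices P)"
    using g by (auto simp: graph_isomorphism_def bij_betw_def)
  have gh: "g (h y) = y" if "y \<in> poly_vertices Q" for y
    using that gV by (simp add: h_def f_inv_into_f)
  have hq0: "h q0 = v0" using gv0 inj P.v0 by (auto simp: h_def)
  \<comment> \<open>A face is the hull of its vertices, so the image face can be written down from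
    the images of the vertices alone.\<close>
  define f where "f F = convex hull (g ` (poly_vertices P \<inter> F))" for F
  have f: "f F face_of Q \<and> poly_vertices Q \<inter> f F = g ` (poly_vertices P \<inter> F)" if F: "F face_of P" for F
  proof -
    obtain F' where F': "F' face_of Q" "poly_vertices Q \<inter> F' = g ` (poly_vertices P \<inter> F)"
      using face_graph_isomorphism[OF PP(1) _ g F] QQ(1) gv0 by auto
    then have "f F = F'" unfolding f_def using face_eq_hull_vertices[OF Q.P F'(1)] by simp
    with F' show ?thesis by simp
  qed
  have mono: "F1 \<subseteq> F2 \<longleftrightarrow> f F1 \<subseteq> f F2" if F: "F1 face_of P" "F2 face_of P" for F1 F2
  proof
    assume "f F1 \<subseteq> f F2"
    then have "g ` (poly_vertices P \<inter> F1) \<subseteq> g ` (poly_vertices P \<inter> F2)"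
      using f[OF F(1)] f[OF F(2)] by blast
    then have "poly_vertices P \<inter> F1 \<subseteq> poly_vertices P \<inter> F2"
      using inj by (auto simp: inj_on_image_subset_iff)
    then show "F1 \<subseteq> F2"
      using face_eq_hull_vertices[OF P.P F(1)] face_eq_hull_vertices[OF P.P F(2)] hull_mono by metis
  qed (auto simp: f_def intro!: hull_mono)
  have "bij_betw f {F. F face_of P} {G. G face_of Q}"
    unfolding bij_betw_def
  proof
    show "inj_on f {F. F face_of P}"
      using mono by (intro inj_onI) (metis mem_Collect_eq subset_antisym subset_refl)
    show "f ` {F. F face_of P} = {G. G face_of Q}"
    proof
      \<comment> \<open>Surjectivity comes from transferring faces along the inverse isomorphism
        \<open>h\<close>.\<close>
      show "{G. G face_of Q} \<subseteq> f ` {F. F face_of P}"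
      proof
        fix G assume "G \<in> {G. G face_of Q}"
        then have G: "G face_of Q" by simp
        obtain F where F: "F face_of P" "poly_vertices P \<inter> F = h ` (poly_vertices Q \<inter> G)"
          using face_graph_isomorphism[OF QQ(1) _ h G] PP(1) hq0 by auto
        have "g ` (poly_vertices P \<inter> F) = poly_vertices Q \<inter> G"
          unfolding F(2) image_image using gh by (auto simp: image_iff)
        then have "f F = G" unfolding f_def using face_eq_hull_vertices[OF Q.P G] by simp
        with F show "G \<in> f ` {F. F face_of P}" by blast
      qed
    qed (use f in auto)
  qed
  then show ?thesis unfolding face_lattice_iso_def using mono by blast
qed

end
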